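(* Let $G=(V,E)$ be a connected complete $p$-partite multigraph, $p\ge2$, with $V=V_1\cup V_2$. Then: (i) If $p\ge3$ or $V_1\ne\emptyset$, then any $V_2$-favorable matching policy $\Phi$ is maximal, that is, $\mathrm{Stab}(G,\Phi)=\mathrm{Ncond}(G)$. (ii) If $p\ge3$, then $\mathrm{Ncond}(\check G)\subset\mathrm{Stab}(G,\Phi)$ for any admissible matching policy $\Phi$.
   Context: A multigraph $G=(V,E)$ has a finite node set $V$ and a set $E$ of edges, each edge joining two distinct nodes or being a self-loop at a node; there are no parallel edges. Write $u - v$ if $u,v$ are joined by an edge ($u-u$ meaning a self-loop at $u$). $V_1=\{u: u-u\}$, $V_2=V\setminus V_1$. For $U\subset V$, $E(U)=\{v\in V:\exists u\in U,\ u-v\}$. The maximal subgraph $\check G=(V,\check E)$ is $G$ with all self-loops deleted. $G$ is complete $p$-partite if $\check G$ is a complete $p$-partite graph, i.e. $V$ is partitioned into $p$ nonempty independent sets of $\check G$ with an edge between every pair of nodes from different sets. An independent set of $G$ is a nonempty set of nodes containing no edge of $G$ (in particular no node with a self-loop); $\mathbb I(G)$ is the set of independent sets. $\mathscr M(V)$ is the set of probability measures on $V$ with full support, and $\mathrm{Ncond}(G)=\{\mu\in\mathscr M(V):\ \mu(I)<\mu(E(I))\ \ \forall I\in\mathbb I(G)\}$; $\mathrm{Ncond}(\check G)$ is defined in the same way for $\check G$. Matching model $(G,\Phi,\mu)$: at each time $n\ge1$ one item enters, with class $C_n\in V$, $(C_n)$ i.i.d. of law $\mu$. If the buffer contains an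 item of a class in $E(\{C_n\})$, the incoming item is matched with one such item chosen by the policy $\Phi$ and both leave immediately; otherwise it is stored. $W_n$ is the word over $V$ listing the classes of unmatched items after the arrival at time $n$, in order of arrival. $\Phi$ is admissible if the choice of the match depends solely on the queue detail (the word) upon arrival and the incoming class, and possibly on an independent uniform draw in case of a tie. Then $(W_n)$ is a Markov chain on the set of finite words $w$ over $V$ with $|w|_i|w|_j=0$ for all distinct $i,j$ with $i-j$, and $|w|_i\le1$ for $i\in V_1$. The model is stable if $(W_n)$ is positive recurrent; $\mathrm{Stab}(G,\Phi)$ is the set of $\mu\in\mathscr M(V)$ for which it is stable. An admissible policy is $V_2$-favorable if any incoming item always prioritizes a match with a compatible stored item of class in $V_2$ over a compatible stored item of class in $V_1$: it never occurs that an incoming item is matched with an item of class in $V_1$ while a compatible item of class in $V_2$ is stored in the buffer. *)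

theory Defs
  imports "HOL-Probability.Probability"
begin

section \<open>Multigraphs\<close>

text \<open>
  A multigraph is given by its node set and its set of edges. An edge between \<open>u\<close> and \<open>v\<close> is
  the set \<open>{u, v}\<close>, so that a self-loop at \<open>u\<close> is the singleton \<open>{u}\<close>; this excludes parallel
  edges and makes adjacency symmetric. Below, \<open>V\<^sub>1\<close> is \<open>loop_nodes\<close> and \<open>V\<^sub>2\<close> is \<open>loopless_nodes\<close>.
\<close>

definition multigraph :: "'a set \<Rightarrow> 'a set set \<Rightarrow> bool" where
  "multigraph V E \<longleftrightarrow> finite V \<and> (\<forall>e\<in>E. \<exists>u\<in>V. \<exists>v\<in>V. e = {u, v})"

definition adj :: "'a set set \<Rightarrow> 'a \<Rightarrow> 'a \<Rightarrow> bool" where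
  "adj E u v \<longleftrightarrow> {u, v} \<in> E"

definition loop_nodes :: "'a set \<Rightarrow> 'a set set \<Rightarrow> 'a set" where
  "loop_nodes V E = {u\<in>V. adj E u u}"

definition loopless_nodes :: "'a set \<Rightarrow> 'a set set \<Rightarrow> 'a set" where
  "loopless_nodes V E = V - loop_nodes V E"

definition nbrs :: "'a set \<Rightarrow> 'a set set \<Rightarrow> 'a set \<Rightarrow> 'a set" where
  "nbrs V E U = {v\<in>V. \<exists>u\<in>U. adj E u v}"

text \<open>The edge set of the maximal subgraph: all self-loops are deleted.\<close>

definition no_loops :: "'a set set \<Rightarrow> 'a set set" where
  "no_loops E = {e\<in>E. \<forall>u. e \<noteq> {u}}"

definition graph_connected :: "'a set \<Rightarrow> 'a set set \<Rightarrow> bool" where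
  "graph_connected V E \<longleftrightarrow> (\<forall>u\<in>V. \<forall>v\<in>V. (adj E)\<^sup>*\<^sup>* u v)"

definition indep_sets_of :: "'a set \<Rightarrow> 'a set set \<Rightarrow> 'a set set" where
  "indep_sets_of V E = {I. I \<noteq> {} \<and> I \<subseteq> V \<and> (\<forall>u\<in>I. \<forall>v\<in>I. \<not> adj E u v)}"

definition complete_multipartite :: "'a set \<Rightarrow> 'a set set \<Rightarrow> nat \<Rightarrow> bool" where
  "complete_multipartite V E p \<longleftrightarrow>
     (\<exists>P. partition_on V P \<and> card P = p \<and>
          P \<subseteq> indep_sets_of V (no_loops E) \<and>
          (\<forall>A\<in>P. \<forall>B\<in>P. A \<noteq> B \<longrightarrow> (\<forall>u\<in>A. \<forall>v\<in>B. adj (no_loops E) u v)))"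

text \<open>Probability measures on \<open>V\<close> with full support are the \<open>pmf\<close>s with support \<open>V\<close>.\<close>

definition full_support :: "'a set \<Rightarrow> 'a pmf set" where
  "full_support V = {\<mu>. set_pmf \<mu> = V}"

definition Ncond :: "'a set \<Rightarrow> 'a set set \<Rightarrow> 'a pmf set" where
  "Ncond V E = {\<mu>\<in>full_support V. \<forall>I\<in>indep_sets_of V E.
     measure_pmf.prob \<mu> I < measure_pmf.prob \<mu> (nbrs V E I)}"


section \<open>Positive recurrence\<close>

text \<open>
  \<open>path_pmf K n x\<close> is the law of \<open>[X\<^sub>1, \<dots>, X\<^sub>n]\<close> for the Markov chain with transition kernel \<open>K\<close>
  and \<open>X\<^sub>0 = x\<close>.
\<close>

primrec path_pmf :: "('s \<Rightarrow> 's pmf) \<Rightarrow> nat \<Rightarrow> 's \<Rightarrow> 's list pmf" where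
  "path_pmf K 0 x = return_pmf []"
| "path_pmf K (Suc n) x = bind_pmf (K x) (\<lambda>y. map_pmf (\<lambda>ys. y # ys) (path_pmf K n y))"

text \<open>The probability that the first return to \<open>x\<close> (at a time \<open>\<ge> 1\<close>) takes place at time \<open>n\<close>.\<close>

definition first_return_prob :: "('s \<Rightarrow> 's pmf) \<Rightarrow> 's \<Rightarrow> nat \<Rightarrow> real" where
  "first_return_prob K x n =
     measure_pmf.prob (path_pmf K n x) {xs. xs \<noteq> [] \<and> last xs = x \<and> x \<notin> set (butlast xs)}"

text \<open>The return time is almost surely finite and has finite expectation.\<close>

definition positive_recurrent_state :: "('s \<Rightarrow> 's pmf) \<Rightarrow> 's \<Rightarrow> bool" where
  "positive_recurrent_state K x \<longleftrightarrow>
     first_return_prob K x sums 1 \<and> summable (\<lambda>n. real n * first_return_prob K x n)"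

definition positive_recurrent :: "('s \<Rightarrow> 's pmf) \<Rightarrow> 's set \<Rightarrow> bool" where
  "positive_recurrent K S \<longleftrightarrow> (\<forall>x\<in>S. positive_recurrent_state K x)"


section \<open>The matching model\<close>

definition buffer_words :: "'a set \<Rightarrow> 'a set set \<Rightarrow> 'a list set" where
  "buffer_words V E = {w\<in>lists V.
     (\<forall>i\<in>V. \<forall>j\<in>V. i \<noteq> j \<and> adj E i j \<longrightarrow> count_list w i * count_list w j = 0) \<and>
     (\<forall>i\<in>loop_nodes V E. count_list w i \<le> 1)}"

text \<open>
  Given the buffer word \<open>w\<close> and the class \<open>c\<close> of the incoming item, a policy returns the law of the
  position in \<open>w\<close> (counted from \<open>0\<close>) of the item with which the incoming item is matched. The law
  is that of a function of \<open>w\<close>, \<open>c\<close> and an independent uniform draw. Its value matters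
  only if \<open>w\<close> is a possible buffer word containing an item compatible with \<open>c\<close>.
\<close>

type_synonym 'a policy = "'a list \<Rightarrow> 'a \<Rightarrow> nat pmf"

definition compatible_positions :: "'a set set \<Rightarrow> 'a list \<Rightarrow> 'a \<Rightarrow> nat set" where
  "compatible_positions E w c = {i. i < length w \<and> adj E c (w ! i)}"

definition admissible :: "'a set \<Rightarrow> 'a set set \<Rightarrow> 'a policy \<Rightarrow> bool" where
  "admissible V E \<Phi> \<longleftrightarrow> (\<forall>w\<in>buffer_words V E. \<forall>c\<in>V.
     compatible_positions E w c \<noteq> {} \<longrightarrow> set_pmf (\<Phi> w c) \<subseteq> compatible_positions E w c)"

definition V2_favorable :: "'a set \<Rightarrow> 'a set set \<Rightarrow> 'a policy \<Rightarrow> bool" where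
  "V2_favorable V E \<Phi> \<longleftrightarrow> admissible V E \<Phi> \<and>
     (\<forall>w\<in>buffer_words V E. \<forall>c\<in>V.
        (\<exists>j\<in>compatible_positions E w c. w ! j \<in> loopless_nodes V E) \<longrightarrow>
        (\<forall>i\<in>set_pmf (\<Phi> w c). w ! i \<notin> loop_nodes V E))"

definition delete_nth :: "nat \<Rightarrow> 'a list \<Rightarrow> 'a list" where
  "delete_nth i w = take i w @ drop (Suc i) w"

text \<open>The transition kernel of the buffer-word chain.\<close>

definition matching_kernel :: "'a set set \<Rightarrow> 'a policy \<Rightarrow> 'a pmf \<Rightarrow> 'a list \<Rightarrow> 'a list pmf" where
  "matching_kernel E \<Phi> \<mu> w = bind_pmf \<mu> (\<lambda>c.
     if compatible_positions E w c = {} then return_pmf (w @ [c])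
     else map_pmf (\<lambda>i. delete_nth i w) (\<Phi> w c))"

definition Stab :: "'a set \<Rightarrow> 'a set set \<Rightarrow> 'a policy \<Rightarrow> 'a pmf set" where
  "Stab V E \<Phi> =
     {\<mu>\<in>full_support V. positive_recurrent (matching_kernel E \<Phi> \<mu>) (buffer_words V E)}"

end

theory Submission
  imports Defs
begin

text \<open>
  In a complete multipartite multigraph two items of different parts are always compatible, so all
  stored items belong to a single part \<open>A\<close>. An incoming item outside \<open>A\<close> then removes a stored item,
  an incoming item of \<open>A\<close> without self-loop is stored, and an incoming item with self-loop in \<open>A\<close>
  either is stored or removes its own copy (\<open>arrival_cases\<close>). Items with self-loops occupy a bounded
  part of the buffer, so stability depends on the number of stored items of \<open>V\<^sub>2\<close> only. This
  number increases at rate \<open>\<mu> (A \<inter> V\<^sub>2)\<close>. It decreases at rate at most \<open>\<mu> (V - A)\<close>, and exactly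
  at this rate while positive if the policy is \<open>V\<^sub>2\<close>-favorable. Since the neighbourhood of any
  independent subset of \<open>A\<close> is \<open>V - A\<close>, the condition \<open>Ncond\<close> says precisely that
  \<open>\<mu> (A \<inter> V\<^sub>2) < \<mu> (V - A)\<close> for every part \<open>A\<close> (\<open>Ncond_iff\<close>).

  Under this condition the count of \<open>V\<^sub>2\<close>-items has a uniformly negative drift outside finitely
  many words, and Foster's criterion gives positive recurrence (\<open>positive_recurrent_if_prioritized\<close>).
  If the condition fails for some \<open>A\<close>, the count of items of \<open>A \<inter> V\<^sub>2\<close> is a submartingale, whatever
  the policy, and the mean return time to the empty buffer is infinite
  (\<open>positive_recurrent_imp_less\<close>). For an arbitrary admissible policy, the total number of stored items
  plays the same role: while positive it has drift at most \<open>\<mu> A - \<mu> (V - A)\<close>, which is negative under \<open>Ncond\<close> of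
  the maximal subgraph.

  Both recurrence criteria are derived from the tail of the return time: positive recurrence is its
  summability (\<open>positive_recurrent_state_iff\<close>), and the tail obeys a linear one-step recursion. Foster's
  criterion (\<open>foster_lyapunov\<close>) becomes a comparison with a supersolution of that recursion, and
  the converse (\<open>submartingale_not_positive_recurrent\<close>) a lower bound of order \<open>1 / n\<close>.
\<close>

section \<open>Tails of hitting times\<close>

lemma prob_bind_pmf:
  "measure_pmf.prob (bind_pmf p f) A = (\<integral>z. measure_pmf.prob (f z) A \<partial>p)"
proof -
  have "emeasure (bind_pmf p f) A = (\<integral>\<^sup>+z. ennreal (measure_pmf.prob (f z) A) \<partial>p)"
    by (simp add: measure_pmf.emeasure_eq_measure[symmetric])
  also have "\<dots> = ennreal (\<integral>z. measure_pmf.prob (f z) A \<partial>p)"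
    by (intro nn_integral_eq_integral measure_pmf.integrable_const_bound[where B=1]) auto
  finally show ?thesis
    by (simp add: measure_pmf.emeasure_eq_measure)
qed

text \<open>
  \<open>avoid_prob K x n y\<close> is the tail of the hitting time: the probability that, from \<open>y\<close>, the time
  \<open>\<tau> \<ge> 1\<close> of the first visit to \<open>x\<close> exceeds \<open>n\<close>. Unlike the first return probabilities it satisfies
  a one-step recursion in the starting state, which is what every argument below runs on.
\<close>

definition avoid_prob :: "('s \<Rightarrow> 's pmf) \<Rightarrow> 's \<Rightarrow> nat \<Rightarrow> 's \<Rightarrow> real" where
  "avoid_prob K x n y = measure_pmf.prob (path_pmf K n y) {xs. x \<notin> set xs}"

lemma avoid_prob_nonneg: "0 \<le> avoid_prob K x n y"
  and avoid_prob_le_1: "avoid_prob K x n y \<le> 1"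
  by (simp_all add: avoid_prob_def)

lemma avoid_prob_0 [simp]: "avoid_prob K x 0 y = 1"
  by (simp add: avoid_prob_def)

lemma avoid_prob_Suc:
  "avoid_prob K x (Suc n) y = (\<integral>z. indicator (- {x}) z * avoid_prob K x n z \<partial>K y)"
proof -
  have "(\<lambda>ys. z # ys) -` {xs. x \<notin> set xs} = (if z = x then {} else {xs. x \<notin> set xs})" for z
    by auto
  then show ?thesis
    by (auto simp: avoid_prob_def prob_bind_pmf indicator_def intro!: Bochner_Integration.integral_cong)
qed

lemma integrable_avoid_prob:
  "integrable (measure_pmf p) (\<lambda>z. indicator A z * avoid_prob K x n z)"
  by (rule measure_pmf.integrable_const_bound[where B=1])
     (auto simp: avoid_prob_nonneg avoid_prob_le_1 indicator_def)

lemma avoid_prob_Suc_le: "avoid_prob K x (Suc n) y \<le> avoid_prob K x n y"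
proof (induction n arbitrary: y)
  case 0
  show ?case by (simp add: avoid_prob_le_1)
next
  case (Suc n)
  have "avoid_prob K x (Suc (Suc n)) y = (\<integral>z. indicator (- {x}) z * avoid_prob K x (Suc n) z \<partial>K y)"
    by (rule avoid_prob_Suc)
  also have "\<dots> \<le> (\<integral>z. indicator (- {x}) z * avoid_prob K x n z \<partial>K y)"
    by (intro integral_mono integrable_avoid_prob mult_left_mono Suc) auto
  also have "\<dots> = avoid_prob K x (Suc n) y"
    by (simp add: avoid_prob_Suc)
  finally show ?case .
qed

lemma avoid_prob_antimono: "m \<le> n \<Longrightarrow> avoid_prob K x n y \<le> avoid_prob K x m y"
  by (rule lift_Suc_antimono_le[of "\<lambda>n. avoid_prob K x n y"]) (rule avoid_prob_Suc_le)

lemma length_path_pmf: "xs \<in> set_pmf (path_pmf K n y) \<Longrightarrow> length xs = n"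
  by (induction n arbitrary: y xs) auto

text \<open>
  Paths are built from the front, whereas \<open>first_return_prob\<close> singles out the last state; this
  consistency lets paths of lengths \<open>n\<close> and \<open>n + 1\<close> be compared on one space.
\<close>

lemma map_butlast_path_pmf: "map_pmf butlast (path_pmf K (Suc n) y) = path_pmf K n y"
proof (induction n arbitrary: y)
  case 0
  show ?case by (simp add: map_bind_pmf)
next
  case (Suc n)
  have "map_pmf (\<lambda>ys. butlast (z # ys)) (path_pmf K (Suc n) z) = map_pmf ((#) z) (path_pmf K n z)"
    for z
  proof -
    have "map_pmf (\<lambda>ys. butlast (z # ys)) (path_pmf K (Suc n) z)
      = map_pmf (\<lambda>ys. z # butlast ys) (path_pmf K (Suc n) z)"
      by (intro map_pmf_cong refl) (auto dest!: length_path_pmf simp del: path_pmf.simps)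
    then show ?thesis
      by (simp add: Suc[symmetric] map_pmf_comp del: path_pmf.simps)
  qed
  then show ?case
    by (subst path_pmf.simps(2)) (simp add: map_bind_pmf map_pmf_comp del: path_pmf.simps(2), simp)
qed

lemma first_return_prob_0 [simp]: "first_return_prob K x 0 = 0"
  by (simp add: first_return_prob_def)

lemma first_return_prob_Suc:
  "first_return_prob K x (Suc n) = avoid_prob K x n x - avoid_prob K x (Suc n) x"
proof -
  let ?p = "path_pmf K (Suc n) x"
  let ?R = "{xs. xs \<noteq> [] \<and> last xs = x \<and> x \<notin> set (butlast xs)}"
  have "avoid_prob K x n x = measure_pmf.prob ?p {xs. x \<notin> set (butlast xs)}"
    unfolding avoid_prob_def map_butlast_path_pmf[of K n x, symmetric] by (simp add: vimage_def del: path_pmf.simps)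
  also have "\<dots> = measure_pmf.prob ?p (?R \<union> {xs. x \<notin> set xs})"
  proof (rule measure_pmf.finite_measure_eq_AE)
    have "x \<notin> set (butlast xs) \<longleftrightarrow> xs \<in> ?R \<union> {xs. x \<notin> set xs}" if "xs \<in> set_pmf ?p" for xs
      using length_path_pmf[OF that] by (cases xs rule: rev_cases) auto
    then show "AE xs in ?p. xs \<in> {xs. x \<notin> set (butlast xs)} \<longleftrightarrow> xs \<in> ?R \<union> {xs. x \<notin> set xs}"
      by (auto simp: AE_measure_pmf_iff simp del: path_pmf.simps)
  qed auto
  also have "\<dots> = measure_pmf.prob ?p ?R + measure_pmf.prob ?p {xs. x \<notin> set xs}"
    by (rule measure_pmf.finite_measure_Union) auto
  finally show ?thesis
    by (simp add: first_return_prob_def avoid_prob_def del: path_pmf.simps)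
qed

lemma sum_first_return_prob: "(\<Sum>k<Suc n. first_return_prob K x k) = 1 - avoid_prob K x n x"
  by (induction n) (simp_all add: first_return_prob_Suc)

text \<open>
  Summation by parts: the truncated form of \<open>E[\<tau>] = (\<Sum>k. P(\<tau> > k))\<close>, with the boundary term
  \<open>n P(\<tau> > n)\<close> kept explicit.
\<close>

lemma sum_avoid_prob:
  "(\<Sum>k<n. avoid_prob K x k x) =
     (\<Sum>k<Suc n. real k * first_return_prob K x k) + real n * avoid_prob K x n x"
  by (induction n) (simp_all add: first_return_prob_Suc algebra_simps)

text \<open>
  The tail-sum formula for the expectation turns positive recurrence into summability of the tail of
  the return time. If the tail is summable it vanishes, so the return is almost sure, and the boundary
  term of the summation by parts can be dropped. Conversely the boundary term is controlled by
  \<open>n P(\<tau> > n) \<le> (\<Sum>k > n. k P(\<tau> = k))\<close>, which needs the return to be almost sure.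
\<close>

lemma positive_recurrent_state_iff:
  "positive_recurrent_state K x \<longleftrightarrow> summable (\<lambda>n. avoid_prob K x n x)"
proof
  assume S: "summable (\<lambda>n. avoid_prob K x n x)"
  then have lim: "(\<lambda>n. avoid_prob K x n x) \<longlonglongrightarrow> 0"
    by (rule summable_LIMSEQ_zero)
  have "(\<lambda>n. \<Sum>k<Suc n. first_return_prob K x k) \<longlonglongrightarrow> 1 - 0"
    unfolding sum_first_return_prob by (intro tendsto_diff tendsto_const lim)
  then have "first_return_prob K x sums 1"
    unfolding sums_def using LIMSEQ_imp_Suc[of "\<lambda>n. \<Sum>k<n. first_return_prob K x k" 1] by simp
  moreover have "summable (\<lambda>n. real n * first_return_prob K x n)"
  proof (rule summableI_nonneg_bounded)
    fix n
    show nonneg: "0 \<le> real n * first_return_prob K x n" for n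
      by (simp add: first_return_prob_def)
    have "(\<Sum>k<n. real k * first_return_prob K x k) \<le> (\<Sum>k<Suc n. real k * first_return_prob K x k)"
      using nonneg[of n] by simp
    also have "\<dots> \<le> (\<Sum>k<n. avoid_prob K x k x)"
      by (simp add: sum_avoid_prob avoid_prob_nonneg)
    also have "\<dots> \<le> (\<Sum>k. avoid_prob K x k x)"
      by (intro sum_le_suminf S) (auto simp: avoid_prob_nonneg)
    finally show "(\<Sum>k<n. real k * first_return_prob K x k) \<le> (\<Sum>k. avoid_prob K x k x)" .
  qed
  ultimately show "positive_recurrent_state K x"
    by (simp add: positive_recurrent_state_def)
next
  let ?f = "first_return_prob K x"
  assume "positive_recurrent_state K x"
  then have one: "?f sums 1" and S: "summable (\<lambda>n. real n * ?f n)"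
    by (auto simp: positive_recurrent_state_def)
  show "summable (\<lambda>n. avoid_prob K x n x)"
  proof (rule summableI_nonneg_bounded)
    fix n
    have nonneg: "0 \<le> ?f n" for n
      by (simp add: first_return_prob_def)
    have sum_f: "summable ?f" using one by (rule sums_summable)
    have "real n * avoid_prob K x n x = real n * (\<Sum>k. ?f (k + Suc n))"
      using suminf_minus_initial_segment[OF sum_f, of "Suc n"] sums_unique[OF one]
      by (simp add: sum_first_return_prob del: sum.lessThan_Suc)
    also have "\<dots> = (\<Sum>k. real n * ?f (k + Suc n))"
      using sum_f by (intro suminf_mult[symmetric]) (simp add: summable_ignore_initial_segment del: add_Suc_right)
    also have "\<dots> \<le> (\<Sum>k. real (k + Suc n) * ?f (k + Suc n))"
      by (intro suminf_le summable_mult summable_ignore_initial_segment[OF S]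
            summable_ignore_initial_segment[OF sum_f] mult_right_mono nonneg) auto
    finally show "(\<Sum>k<n. avoid_prob K x k x) \<le> (\<Sum>k. real k * ?f k)"
      using suminf_minus_initial_segment[OF S, of "Suc n"] by (simp add: sum_avoid_prob)
  qed (rule avoid_prob_nonneg)
qed

section \<open>Drift criteria\<close>

text \<open>
  The expected hitting time of \<open>x\<close> is the least nonnegative solution of \<open>h = 1 + E[h; not at x]\<close>, so
  any nonnegative supersolution bounds it. The partial sums of the tail are the iterates of this
  equation started at \<open>0\<close> and stay below \<open>h\<close> by monotonicity.
\<close>

lemma summable_avoid_prob:
  fixes h :: "'s \<Rightarrow> real"
  assumes closed: "\<And>y. y \<in> S \<Longrightarrow> set_pmf (K y) \<subseteq> S"
    and nonneg: "\<And>y. y \<in> S \<Longrightarrow> 0 \<le> h y"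
    and int: "\<And>y. y \<in> S \<Longrightarrow> integrable (K y) h"
    and le: "\<And>y. y \<in> S \<Longrightarrow> 1 + (\<integral>z. indicator (- {x}) z * h z \<partial>K y) \<le> h y"
    and "y \<in> S"
  shows "summable (\<lambda>n. avoid_prob K x n y)"
proof (rule summableI_nonneg_bounded)
  have int': "integrable (K y) (\<lambda>z. indicator (- {x}) z * h z)" if "y \<in> S" for y
    using int[OF that] integrable_mult_indicator[of "- {x}" "K y" h] by simp
  show "(\<Sum>k<n. avoid_prob K x k y) \<le> h y" for n
    using \<open>y \<in> S\<close>
  proof (induction n arbitrary: y)
    case (Suc n)
    have "(\<Sum>k<Suc n. avoid_prob K x k y)
        = 1 + (\<Sum>k<n. \<integral>z. indicator (- {x}) z * avoid_prob K x k z \<partial>K y)"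
      by (subst sum.lessThan_Suc_shift) (simp add: avoid_prob_Suc)
    also have "(\<Sum>k<n. \<integral>z. indicator (- {x}) z * avoid_prob K x k z \<partial>K y)
        = (\<integral>z. indicator (- {x}) z * (\<Sum>k<n. avoid_prob K x k z) \<partial>K y)"
      by (subst Bochner_Integration.integral_sum[symmetric])
         (auto simp: integrable_avoid_prob sum_distrib_left)
    also have "\<dots> \<le> (\<integral>z. indicator (- {x}) z * h z \<partial>K y)"
    proof (rule integral_mono_AE)
      show "integrable (K y) (\<lambda>z. indicator (- {x}) z * (\<Sum>k<n. avoid_prob K x k z))"
        unfolding sum_distrib_left by (intro Bochner_Integration.integrable_sum integrable_avoid_prob)
      show "AE z in K y. indicator (- {x}) z * (\<Sum>k<n. avoid_prob K x k z) \<le> indicator (- {x}) z * h z"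
        using closed[OF Suc.prems] by (intro AE_pmfI mult_left_mono Suc.IH) auto
    qed (rule int'[OF Suc.prems])
    finally show ?case using le[OF Suc.prems] by simp
  qed (use nonneg in simp)
qed (rule avoid_prob_nonneg)

text \<open>
  Reachability by a single path of positive probability already pushes the tail below \<open>1\<close>. As the tail
  decreases in \<open>n\<close>, one horizon then serves all states of a finite set.
\<close>

lemma reachable_imp_avoid_prob_less_1:
  assumes "(\<lambda>y z. z \<in> set_pmf (K y))\<^sup>+\<^sup>+ y x"
  shows "\<exists>n. avoid_prob K x n y < 1"
proof -
  have one_step: "avoid_prob K x (Suc n) y < 1"
    if z: "z \<in> set_pmf (K y)" and lt: "indicator (- {x}) z * avoid_prob K x n z < 1" for y z n
  proof -
    let ?g = "\<lambda>z. indicator (- {x}) z * avoid_prob K x n z"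
    have le1: "?g z \<le> 1" for z
      by (simp add: avoid_prob_le_1 indicator_def)
    have int: "integrable (K y) (\<lambda>z. 1 - ?g z)"
      by (intro Bochner_Integration.integrable_diff integrable_avoid_prob) auto
    have "0 < pmf (K y) z * (1 - ?g z)"
      using z lt by (simp add: pmf_positive)
    also have "\<dots> = (\<integral>u. indicator {z} u * (1 - ?g u) \<partial>K y)"
      by (subst integral_measure_pmf_real[of "{z}"]) (auto split: split_indicator_asm)
    also have "\<dots> \<le> (\<integral>u. 1 - ?g u \<partial>K y)"
      using le1 by (intro integral_mono_AE' int AE_pmfI) (auto simp: indicator_def)
    also have "\<dots> = 1 - avoid_prob K x (Suc n) y"
      by (simp add: avoid_prob_Suc integrable_avoid_prob)
    finally show ?thesis by simp
  qed
  show ?thesis using assms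
  proof (induction rule: converse_tranclp_induct)
    case (base y)
    then have "avoid_prob K x (Suc 0) y < 1"
      by (intro one_step[of x]) auto
    then show ?case ..
  next
    case (step y z)
    then obtain n where "avoid_prob K x n z < 1" by auto
    with step(1) have "avoid_prob K x (Suc n) y < 1"
      by (intro one_step[of z]) (auto simp: indicator_def)
    then show ?case ..
  qed
qed

text \<open>
  Foster's criterion, with the recurrence of \<open>x\<close> as conclusion even if \<open>x\<close> lies outside the
  exceptional set \<open>F\<close>. Some multiple of \<open>f\<close> is a supersolution off \<open>F\<close>. On \<open>F\<close> it is
  corrected by the truncated expected hitting time \<open>u y = E[min \<tau> N]\<close>, which is bounded by \<open>N\<close> and
  decreases in one step by exactly \<open>P(\<tau> \<le> N)\<close>: this is at least some \<open>\<delta> > 0\<close> on the finite set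
  \<open>F\<close> if \<open>x\<close> is reachable from there, and never negative. Hence \<open>a f + b u\<close> is a supersolution
  once \<open>a\<close>, and then \<open>b\<close>, are large enough.
\<close>

theorem foster_lyapunov:
  fixes f :: "'s \<Rightarrow> real"
  assumes closed: "\<And>y. y \<in> S \<Longrightarrow> set_pmf (K y) \<subseteq> S"
    and nonneg: "\<And>y. y \<in> S \<Longrightarrow> 0 \<le> f y"
    and int: "\<And>y. y \<in> S \<Longrightarrow> integrable (K y) f"
    and "finite F" and "0 < \<epsilon>"
    and drift: "\<And>y. y \<in> S - F \<Longrightarrow> (\<integral>z. f z \<partial>K y) \<le> f y - \<epsilon>"
    and bound: "\<And>y. y \<in> F \<Longrightarrow> (\<integral>z. f z \<partial>K y) \<le> f y + C"
    and reach: "\<And>y. y \<in> F \<Longrightarrow> (\<lambda>y z. z \<in> set_pmf (K y))\<^sup>+\<^sup>+ y x"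
    and "x \<in> S"
  shows "positive_recurrent_state K x"
proof -
  obtain N where N: "\<And>y. y \<in> F \<Longrightarrow> avoid_prob K x N y < 1"
  proof -
    have "\<forall>y\<in>F. \<exists>n. avoid_prob K x n y < 1"
      using reach reachable_imp_avoid_prob_less_1 by fast
    then obtain n where n: "\<And>y. y \<in> F \<Longrightarrow> avoid_prob K x (n y) y < 1"
      by metis
    have "avoid_prob K x (Max (n ` F)) y < 1" if "y \<in> F" for y
      using n[OF that] avoid_prob_antimono[of "n y" "Max (n ` F)" K x y] that \<open>finite F\<close>
      by (meson Max_ge finite_imageI imageI le_less_trans)
    with that show thesis by blast
  qed
  obtain \<delta> where "0 < \<delta>" and \<delta>: "\<And>y. y \<in> F \<Longrightarrow> avoid_prob K x N y \<le> 1 - \<delta>"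
  proof
    let ?D = "insert 1 ((\<lambda>y. 1 - avoid_prob K x N y) ` F)"
    show "0 < Min ?D"
      using N \<open>finite F\<close> by (subst Min_gr_iff) auto
    show "avoid_prob K x N y \<le> 1 - Min ?D" if "y \<in> F" for y
    proof -
      have "Min ?D \<le> 1 - avoid_prob K x N y"
        using that \<open>finite F\<close> by (intro Min_le) auto
      then show ?thesis by simp
    qed
  qed
  define u where "u y = (\<Sum>k<N. avoid_prob K x k y)" for y
  have u_step: "(\<integral>z. indicator (- {x}) z * u z \<partial>K y) = u y - 1 + avoid_prob K x N y" for y
  proof -
    have "(\<integral>z. indicator (- {x}) z * u z \<partial>K y) = (\<Sum>k<N. avoid_prob K x (Suc k) y)"
      unfolding u_def sum_distrib_left avoid_prob_Suc
      by (rule Bochner_Integration.integral_sum) (rule integrable_avoid_prob)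
    also have "\<dots> = u y - 1 + avoid_prob K x N y"
      using sum.lessThan_Suc_shift[of "\<lambda>k. avoid_prob K x k y" N] by (simp add: u_def)
    finally show ?thesis .
  qed
  have int_u: "integrable (K y) (\<lambda>z. indicator A z * u z)" for y A
    unfolding u_def sum_distrib_left by (intro Bochner_Integration.integrable_sum integrable_avoid_prob)
  \<comment> \<open>\<open>a\<close> makes the drift of \<open>a f\<close> at most \<open>-1\<close> off \<open>F\<close>; \<open>b\<close> outweighs the growth \<open>a C\<close> on \<open>F\<close>.\<close>
  define a where "a = 1 / \<epsilon>"
  define b where "b = (1 + a * \<bar>C\<bar>) / \<delta>"
  have "0 < a" "0 \<le> b" "a * \<epsilon> = 1" "b * \<delta> = 1 + a * \<bar>C\<bar>"
    using \<open>0 < \<epsilon>\<close> \<open>0 < \<delta>\<close> by (auto simp: a_def b_def intro!: divide_nonneg_pos add_nonneg_nonneg)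
  have "summable (\<lambda>n. avoid_prob K x n x)"
  proof (rule summable_avoid_prob[where h = "\<lambda>y. a * f y + b * u y", OF closed])
    fix y assume y: "y \<in> S"
    show "0 \<le> a * f y + b * u y"
      using nonneg[OF y] \<open>0 < a\<close> \<open>0 \<le> b\<close>
      by (auto simp: u_def intro!: add_nonneg_nonneg mult_nonneg_nonneg sum_nonneg avoid_prob_nonneg)
    show "integrable (K y) (\<lambda>y. a * f y + b * u y)"
      using int[OF y] int_u[of y UNIV] by auto
    have int_f: "integrable (K y) (\<lambda>z. indicator (- {x}) z * f z)"
      using int[OF y] integrable_mult_indicator[of "- {x}" "K y" f] by simp
    have "(\<integral>z. indicator (- {x}) z * f z \<partial>K y) \<le> (\<integral>z. f z \<partial>K y)"
      using closed[OF y] nonneg by (intro integral_mono_AE int_f int[OF y] AE_pmfI) (auto simp: indicator_def)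
    then have "a * (\<integral>z. indicator (- {x}) z * f z \<partial>K y) \<le> a * (\<integral>z. f z \<partial>K y)"
      using \<open>0 < a\<close> by simp
    moreover have "(\<integral>z. indicator (- {x}) z * (a * f z + b * u z) \<partial>K y)
        = a * (\<integral>z. indicator (- {x}) z * f z \<partial>K y) + b * (u y - 1 + avoid_prob K x N y)"
      using int_f int_u[of y "- {x}"] unfolding u_step[symmetric]
      by (simp add: distrib_left mult.left_commute[of "indicator _ _"])
    moreover have "1 + a * (\<integral>z. f z \<partial>K y) + b * (u y - 1 + avoid_prob K x N y) \<le> a * f y + b * u y"
    proof (cases "y \<in> F")
      case True
      have "a * (\<integral>z. f z \<partial>K y) \<le> a * (f y + \<bar>C\<bar>)"
        using bound[OF True] \<open>0 < a\<close> by (intro mult_left_mono) auto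
      moreover have "b * (u y - 1 + avoid_prob K x N y) \<le> b * (u y - \<delta>)"
        using \<delta>[OF True] \<open>0 \<le> b\<close> by (intro mult_left_mono) auto
      ultimately show ?thesis
        using \<open>b * \<delta> = 1 + a * \<bar>C\<bar>\<close> by (simp add: algebra_simps)
    next
      case False
      have "a * (\<integral>z. f z \<partial>K y) \<le> a * (f y - \<epsilon>)"
        using drift[of y] False y \<open>0 < a\<close> by (intro mult_left_mono) auto
      moreover have "b * (u y - 1 + avoid_prob K x N y) \<le> b * u y"
        using \<open>0 \<le> b\<close> avoid_prob_le_1[of K x N y] by (intro mult_left_mono) auto
      ultimately show ?thesis
        using \<open>a * \<epsilon> = 1\<close> by (simp add: algebra_simps)
    qed
    ultimately show "1 + (\<integral>z. indicator (- {x}) z * (a * f z + b * u z) \<partial>K y) \<le> a * f y + b * u y"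
      by linarith
  qed (use \<open>x \<in> S\<close> in auto)
  then show ?thesis
    by (simp add: positive_recurrent_state_iff)
qed

text \<open>
  A submartingale with upward jumps at most \<open>1\<close> that vanishes at \<open>x\<close>, and can step from \<open>x\<close>
  to a positive value, does not come back to \<open>x\<close> in finite mean time. Stopped at \<open>x\<close>, its mean at
  time \<open>n\<close> is at least its initial value \<open>f y\<close>, yet at most its largest possible value \<open>f y + n\<close> times
  the probability \<open>P(\<tau> > n)\<close>. So the tail of \<open>\<tau>\<close> decays no faster than
  \<open>1 / n\<close>, and the harmonic series diverges.
\<close>

theorem submartingale_not_positive_recurrent:
  fixes f :: "'s \<Rightarrow> real"
  assumes closed: "\<And>y. y \<in> S \<Longrightarrow> set_pmf (K y) \<subseteq> S"
    and int: "\<And>y. y \<in> S \<Longrightarrow> integrable (K y) f"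
    and sub: "\<And>y. y \<in> S \<Longrightarrow> f y \<le> (\<integral>z. f z \<partial>K y)"
    and jump: "\<And>y z. y \<in> S \<Longrightarrow> z \<in> set_pmf (K y) \<Longrightarrow> f z \<le> f y + 1"
    and "x \<in> S" and "f x = 0" and y: "y \<in> set_pmf (K x)" and "0 < f y"
  shows "\<not> positive_recurrent_state K x"
proof
  \<comment> \<open>Fixing the level \<open>L\<close> in advance makes the lower bound linear in \<open>f y\<close>, so that the submartingale
    property can be applied to it. A bound \<open>f y / (f y + n)\<close> is concave in \<open>f y\<close> and would not iterate.\<close>
  have *: "f y / L \<le> avoid_prob K x n y" if "y \<in> S" "f y + real n \<le> L" "0 < L" for L n y
    using that
  proof (induction n arbitrary: y)
    case 0
    then show ?case by simp
  next
    case (Suc n)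
    have "f y / L \<le> (\<integral>z. f z \<partial>K y) / L"
      using sub[OF \<open>y \<in> S\<close>] \<open>0 < L\<close> by (intro divide_right_mono) auto
    also have "\<dots> = (\<integral>z. f z / L \<partial>K y)"
      by simp
    also have "\<dots> \<le> (\<integral>z. indicator (- {x}) z * avoid_prob K x n z \<partial>K y)"
    proof (intro integral_mono_AE AE_pmfI integrable_avoid_prob)
      show "integrable (K y) (\<lambda>z. f z / L)"
        using int[OF \<open>y \<in> S\<close>] by simp
      fix z assume z: "z \<in> set_pmf (K y)"
      show "f z / L \<le> indicator (- {x}) z * avoid_prob K x n z"
      proof (cases "z = x")
        case False
        have "f z / L \<le> avoid_prob K x n z"
          using jump[OF \<open>y \<in> S\<close> z] closed[OF \<open>y \<in> S\<close>] z Suc.prems by (intro Suc.IH) auto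
        with False show ?thesis by simp
      qed (use \<open>f x = 0\<close> in simp)
    qed
    finally show ?case by (simp add: avoid_prob_Suc)
  qed
  define c where "c = pmf (K x) y * f y"
  have "0 < c"
    using y \<open>0 < f y\<close> by (simp add: c_def pmf_positive)
  have "f y \<le> 1" using jump[OF \<open>x \<in> S\<close> y] \<open>f x = 0\<close> by simp
  have lower: "c * inverse (real (Suc n)) \<le> avoid_prob K x (Suc n) x" for n
  proof -
    have "c * inverse (real (Suc n)) = pmf (K x) y * (f y / real (Suc n))"
      by (simp add: c_def divide_inverse)
    also have "\<dots> \<le> pmf (K x) y * avoid_prob K x n y"
      using closed[OF \<open>x \<in> S\<close>] y \<open>f y \<le> 1\<close> by (intro mult_left_mono *) auto
    also have "\<dots> = (\<integral>z. indicator {y} z * avoid_prob K x n z \<partial>K x)"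
      by (subst integral_measure_pmf_real[of "{y}"]) (auto split: split_indicator_asm)
    also have "\<dots> \<le> (\<integral>z. indicator (- {x}) z * avoid_prob K x n z \<partial>K x)"
      using \<open>0 < f y\<close> \<open>f x = 0\<close>
      by (intro integral_mono integrable_avoid_prob mult_right_mono avoid_prob_nonneg)
         (auto simp: indicator_def)
    finally show ?thesis by (simp add: avoid_prob_Suc)
  qed
  assume "positive_recurrent_state K x"
  then have "summable (\<lambda>n. avoid_prob K x (Suc n) x)"
    by (subst summable_Suc_iff) (simp add: positive_recurrent_state_iff)
  then have "summable (\<lambda>n. c * inverse (real (Suc n)))"
    by (rule summable_comparison_test') (use lower \<open>0 < c\<close> in auto)
  then have "summable (\<lambda>n. inverse (real (Suc n)))"
    using \<open>0 < c\<close> by (simp add: summable_cmult_iff del: of_nat_Suc)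
  then have "summable (\<lambda>n. inverse (real n))"
    by (subst (asm) summable_Suc_iff)
  then show False
    using not_summable_harmonic[where 'a = real] by simp
qed

section \<open>Counting stored items\<close>

lemma expectation_bind_pmf_le:
  fixes f :: "'b \<Rightarrow> real"
  assumes "finite (set_pmf p)" and "\<And>c. c \<in> set_pmf p \<Longrightarrow> finite (set_pmf (q c))"
    and le: "\<And>c z. c \<in> set_pmf p \<Longrightarrow> z \<in> set_pmf (q c) \<Longrightarrow> f z \<le> e c"
  shows "(\<integral>z. f z \<partial>bind_pmf p q) \<le> (\<integral>c. e c \<partial>p)"
proof -
  have "(\<integral>z. f z \<partial>bind_pmf p q) = (\<Sum>c\<in>set_pmf p. pmf p c *\<^sub>R (\<integral>z. f z \<partial>q c))"
    using assms by (intro pmf_expectation_bind) auto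
  also have "\<dots> \<le> (\<Sum>c\<in>set_pmf p. pmf p c *\<^sub>R e c)"
  proof (intro sum_mono scaleR_left_mono)
    fix c assume c: "c \<in> set_pmf p"
    have "(\<integral>z. f z \<partial>q c) \<le> (\<integral>z. e c \<partial>q c)"
      using assms c by (intro integral_mono_AE AE_pmfI integrable_measure_pmf_finite) auto
    then show "(\<integral>z. f z \<partial>q c) \<le> e c" by simp
  qed simp
  also have "\<dots> = (\<integral>c. e c \<partial>p)"
    using assms by (intro integral_measure_pmf[symmetric]) auto
  finally show ?thesis .
qed

definition count_in :: "'a set \<Rightarrow> 'a list \<Rightarrow> real" where
  "count_in U w = real (length (filter (\<lambda>i. i \<in> U) w))"

lemma count_in_nonneg: "0 \<le> count_in U w"
  by (simp add: count_in_def)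

lemma count_in_Nil [simp]: "count_in U [] = 0"
  by (simp add: count_in_def)

lemma count_in_append [simp]: "count_in U (v @ w) = count_in U v + count_in U w"
  by (simp add: count_in_def)

lemma count_in_Cons [simp]: "count_in U (c # w) = indicator U c + count_in U w"
  by (simp add: count_in_def)

lemma count_in_eq_0_iff: "count_in U w = 0 \<longleftrightarrow> set w \<inter> U = {}"
  by (auto simp: count_in_def filter_empty_conv)

lemma split_at_nth:
  assumes "i < length w"
  obtains u v where "w = u @ w ! i # v" and "delete_nth i w = u @ v"
  using id_take_nth_drop[OF assms] by (auto simp: delete_nth_def)

text \<open>
  The transition law given the class of the incoming item. Drifts are computed by bounding the change
  of a function for each incoming class separately and then averaging over the class.
\<close>

definition arrival :: "'a set set \<Rightarrow> 'a policy \<Rightarrow> 'a list \<Rightarrow> 'a \<Rightarrow> 'a list pmf" where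
  "arrival E \<Phi> w c = (if compatible_positions E w c = {} then return_pmf (w @ [c])
     else map_pmf (\<lambda>i. delete_nth i w) (\<Phi> w c))"

lemma matching_kernel_eq: "matching_kernel E \<Phi> \<mu> w = bind_pmf \<mu> (arrival E \<Phi> w)"
  unfolding matching_kernel_def arrival_def ..

section \<open>Complete multipartite multigraphs\<close>

lemma adj_commute: "adj E u v \<longleftrightarrow> adj E v u"
  by (simp add: adj_def insert_commute)

text \<open>
  Complete multipartite multigraphs through their adjacency relation: a node is joined to everything
  outside its part, and inside its part at most to itself.
\<close>

locale multipartite_multigraph =
  fixes V :: "'a set" and E :: "'a set set" and P :: "'a set set"
  assumes finite_V: "finite V"
    and partition: "partition_on V P"
    and two_parts: "2 \<le> card P"
    and adj_iff: "\<And>A u v. A \<in> P \<Longrightarrow> u \<in> A \<Longrightarrow> v \<in> V \<Longrightarrow>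
                    adj E u v \<longleftrightarrow> v \<notin> A \<or> (u = v \<and> u \<in> loop_nodes V E)"
begin

abbreviation "V1 \<equiv> loop_nodes V E"
abbreviation "V2 \<equiv> loopless_nodes V E"

lemma part_subset: "A \<in> P \<Longrightarrow> A \<subseteq> V"
  using partition_onD1[OF partition] by auto

lemma part_of: "v \<in> V \<Longrightarrow> \<exists>A\<in>P. v \<in> A"
  using partition_onD1[OF partition] by auto

lemma other_part_nonempty:
  assumes "A \<in> P"
  shows "V - A \<noteq> {}"
proof -
  have "\<not> P \<subseteq> {A}"
    using two_parts card_mono[of "{A}" P] by auto
  then obtain B where "B \<in> P" "B \<noteq> A" by auto
  then have "B \<noteq> {}" "B \<inter> A = {}" "B \<subseteq> V"
    using partition_onD3[OF partition] partition_onD2[OF partition] part_subset assms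
    by (auto simp: disjoint_def)
  then show ?thesis by auto
qed

text \<open>
  Two stored items of different parts would be compatible, so all stored items belong to one part. For
  the empty word this requires that there is at least one part.
\<close>

lemma buffer_words_eq:
  "buffer_words V E = {w. (\<exists>A\<in>P. set w \<subseteq> A) \<and> (\<forall>i\<in>V1. count_list w i \<le> 1)}"
proof (intro set_eqI iffI CollectI conjI; (elim CollectE conjE)?)
  fix w assume w: "w \<in> buffer_words V E"
  then show "\<forall>i\<in>V1. count_list w i \<le> 1"
    by (auto simp: buffer_words_def)
  show "\<exists>A\<in>P. set w \<subseteq> A"
  proof (cases w)
    case Nil
    have "P \<noteq> {}" using two_parts by auto
    then show ?thesis using Nil by auto
  next
    case (Cons a w')
    then have "a \<in> V" using w by (auto simp: buffer_words_def)
    then obtain A where A: "A \<in> P" "a \<in> A" using part_of by auto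
    have "v \<in> A" if "v \<in> set w" for v
    proof (rule ccontr)
      assume "v \<notin> A"
      have "v \<in> V" using w that by (auto simp: buffer_words_def)
      then have "adj E a v" "a \<noteq> v"
        using adj_iff[OF A, of v] A \<open>v \<notin> A\<close> by auto
      then have "count_list w a * count_list w v = 0"
        using w \<open>a \<in> V\<close> \<open>v \<in> V\<close> by (auto simp: buffer_words_def)
      moreover have "a \<in> set w" using Cons by simp
      ultimately show False
        using that by (metis count_list_0_iff mult_is_0)
    qed
    then show ?thesis using A by auto
  qed
next
  fix w assume "\<exists>A\<in>P. set w \<subseteq> A" and loops: "\<forall>i\<in>V1. count_list w i \<le> 1"
  then obtain A where A: "A \<in> P" "set w \<subseteq> A" by auto
  have "count_list w i * count_list w j = 0" if "i \<in> V" "j \<in> V" "i \<noteq> j" "adj E i j" for i j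
  proof (rule ccontr)
    assume "count_list w i * count_list w j \<noteq> 0"
    then have "i \<in> A" "j \<in> A"
      using A by (auto simp: count_list_0_iff)
    then show False
      using adj_iff[OF A(1), of i j] that by auto
  qed
  then show "w \<in> buffer_words V E"
    using A loops part_subset[OF A(1)] by (auto simp: buffer_words_def)
qed

lemma Nil_in_buffer_words: "[] \<in> buffer_words V E"
  by (simp add: buffer_words_def)

lemma indep_set_subset_part:
  assumes "I \<in> indep_sets_of V E"
  obtains A where "A \<in> P" and "I \<subseteq> A \<inter> V2"
proof -
  obtain u where u: "u \<in> I" "u \<in> V"
    using assms by (auto simp: indep_sets_of_def)
  then obtain A where A: "A \<in> P" "u \<in> A" using part_of by auto
  have "v \<in> A \<inter> V2" if "v \<in> I" for v
    using adj_iff[OF A, of v] assms u that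
    by (auto simp: indep_sets_of_def loopless_nodes_def loop_nodes_def)
  then show thesis using that A by auto
qed

lemma nbrs_of_indep:
  assumes "A \<in> P" and "I \<subseteq> A \<inter> V2" and "I \<noteq> {}"
  shows "nbrs V E I = V - A"
proof -
  have "adj E u v \<longleftrightarrow> v \<notin> A" if "u \<in> I" "v \<in> V" for u v
    using adj_iff[OF assms(1), of u v] assms(2) that by (auto simp: loopless_nodes_def)
  then show ?thesis
    using assms(3) by (auto simp: nbrs_def)
qed

lemma part_Int_loopless_indep:
  assumes "A \<in> P" and "A \<inter> V2 \<noteq> {}"
  shows "A \<inter> V2 \<in> indep_sets_of V E"
proof -
  have "\<not> adj E u v" if "u \<in> A \<inter> V2" "v \<in> A \<inter> V2" for u v
    using adj_iff[OF assms(1), of u v] that part_subset[OF assms(1)] by (auto simp: loopless_nodes_def)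
  then show ?thesis
    using assms part_subset[OF assms(1)] by (auto simp: indep_sets_of_def)
qed

text \<open>
  An independent set \<open>I\<close> lies in \<open>A \<inter> V2\<close> for some part \<open>A\<close>, and its neighbourhood is \<open>V - A\<close> whatever
  \<open>I\<close> is. So the stability condition is tightest for the full set \<open>A \<inter> V2\<close>. If that set is empty, the
  inequality holds because \<open>\<mu>\<close> charges every node and there is a second part.
\<close>

lemma Ncond_iff:
  assumes "set_pmf \<mu> = V"
  shows "\<mu> \<in> Ncond V E \<longleftrightarrow>
    (\<forall>A\<in>P. measure_pmf.prob \<mu> (A \<inter> V2) < measure_pmf.prob \<mu> (V - A))"
proof
  assume N: "\<mu> \<in> Ncond V E"
  show "\<forall>A\<in>P. measure_pmf.prob \<mu> (A \<inter> V2) < measure_pmf.prob \<mu> (V - A)"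
  proof
    fix A assume A: "A \<in> P"
    show "measure_pmf.prob \<mu> (A \<inter> V2) < measure_pmf.prob \<mu> (V - A)"
    proof (cases "A \<inter> V2 = {}")
      case True
      have "measure_pmf.prob \<mu> (V - A) \<noteq> 0"
        using other_part_nonempty[OF A] assms by (auto simp: measure_pmf_zero_iff)
      then show ?thesis
        by (simp add: True zero_less_measure_iff)
    next
      case False
      then have "nbrs V E (A \<inter> V2) = V - A"
        by (intro nbrs_of_indep[OF A]) auto
      then show ?thesis
        using N part_Int_loopless_indep[OF A False] by (auto simp: Ncond_def)
    qed
  qed
next
  assume less: "\<forall>A\<in>P. measure_pmf.prob \<mu> (A \<inter> V2) < measure_pmf.prob \<mu> (V - A)"
  have "measure_pmf.prob \<mu> I < measure_pmf.prob \<mu> (nbrs V E I)" if I: "I \<in> indep_sets_of V E" for I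
  proof -
    obtain A where A: "A \<in> P" "I \<subseteq> A \<inter> V2"
      using indep_set_subset_part[OF I] .
    then have "measure_pmf.prob \<mu> I \<le> measure_pmf.prob \<mu> (A \<inter> V2)"
      by (intro measure_pmf.finite_measure_mono) auto
    also have "\<dots> < measure_pmf.prob \<mu> (V - A)" using less A by auto
    also have "V - A = nbrs V E I"
      using I nbrs_of_indep[OF A] by (auto simp: indep_sets_of_def)
    finally show ?thesis .
  qed
  then show "\<mu> \<in> Ncond V E"
    using assms by (auto simp: Ncond_def full_support_def)
qed

end

section \<open>Transitions of the buffer\<close>

locale multipartite_matching = multipartite_multigraph V E P
  for V :: "'a set" and E :: "'a set set" and P :: "'a set set" +
  fixes \<mu> :: "'a pmf" and \<Phi> :: "'a policy"
  assumes support: "set_pmf \<mu> = V"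
    and adm: "admissible V E \<Phi>"
begin

abbreviation "K \<equiv> matching_kernel E \<Phi> \<mu>"
abbreviation "S \<equiv> buffer_words V E"

text \<open>
  The three kinds of transition from a buffer of items of the part \<open>A\<close>. An item of another part is
  compatible with the whole buffer and removes one item, the choice of which is all that the policy
  decides. An item of \<open>A\<close> is compatible at most with a stored copy of itself, which requires a
  self-loop. In the last case the disjunct \<open>w = []\<close> is needed because the empty word belongs to
  every part.
\<close>

lemma arrival_cases:
  assumes w: "w \<in> S" and A: "A \<in> P" "set w \<subseteq> A" and c: "c \<in> V"
    and z: "z \<in> set_pmf (arrival E \<Phi> w c)"
  obtains (other_part) u a v where "c \<notin> A" and "w = u @ a # v" and "z = u @ v"
      and "\<exists>i\<in>set_pmf (\<Phi> w c). w ! i = a"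
  | (self_match) u v where "c \<in> A" and "c \<in> V1" and "w = u @ c # v" and "z = u @ v"
  | (stored) "w = [] \<or> c \<in> A" and "c \<in> V1 \<Longrightarrow> c \<notin> set w" and "z = w @ [c]"
proof (cases "compatible_positions E w c = {}")
  case True
  then have "\<not> adj E c a" if "a \<in> set w" for a
    using that by (auto simp: compatible_positions_def in_set_conv_nth)
  then have no: "c \<in> A \<and> \<not> (c = a \<and> c \<in> V1)" if "a \<in> set w" for a
    using that adj_iff[OF A(1), of a c] A(2) c adj_commute[of E a c] by auto
  have "w = [] \<or> c \<in> A" using no[of "hd w"] by (cases w) auto
  moreover have "c \<in> V1 \<Longrightarrow> c \<notin> set w" using no by auto
  moreover have "z = w @ [c]" using z True by (simp add: arrival_def)
  ultimately show thesis by (rule stored)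
next
  case False
  then obtain i where i: "i \<in> set_pmf (\<Phi> w c)" and z: "z = delete_nth i w"
    using z by (auto simp: arrival_def)
  have "i \<in> compatible_positions E w c"
    using adm w c False i by (auto simp: admissible_def)
  then have "i < length w" and adj: "adj E (w ! i) c"
    by (auto simp: compatible_positions_def adj_commute)
  then obtain u v where uv: "w = u @ w ! i # v" "delete_nth i w = u @ v"
    using split_at_nth by blast
  show thesis
  proof (cases "c \<in> A")
    case True
    moreover have "w ! i \<in> A"
      using A(2) \<open>i < length w\<close> nth_mem by blast
    ultimately have "w ! i = c" "c \<in> V1"
      using adj adj_iff[OF A(1), of "w ! i" c] c by auto
    with True uv z show thesis by (intro self_match) auto
  next
    case False
    with uv z i show thesis by (intro other_part) auto
  qed
qed

lemma word_part:
  assumes "w \<in> S"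
  obtains A where "A \<in> P" and "set w \<subseteq> A"
  using assms by (auto simp: buffer_words_eq)

lemma remove_in_buffer_words: "u @ a # v \<in> S \<Longrightarrow> u @ v \<in> S"
proof -
  assume *: "u @ a # v \<in> S"
  have "count_list (u @ v) i \<le> count_list (u @ a # v) i" for i
    by simp
  moreover obtain A where A: "A \<in> P" "set (u @ a # v) \<subseteq> A"
    using word_part[OF *] .
  moreover have "\<forall>i\<in>V1. count_list (u @ a # v) i \<le> 1"
    using * by (simp add: buffer_words_eq)
  ultimately have "\<forall>i\<in>V1. count_list (u @ v) i \<le> 1"
    by (meson order_trans)
  moreover have "set (u @ v) \<subseteq> A" using A by auto
  ultimately show "u @ v \<in> S"
    using A(1) unfolding buffer_words_eq by blast
qed

lemma arrival_closed:
  assumes w: "w \<in> S" and c: "c \<in> V"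
  shows "set_pmf (arrival E \<Phi> w c) \<subseteq> S"
proof
  fix z assume z: "z \<in> set_pmf (arrival E \<Phi> w c)"
  obtain A where A: "A \<in> P" "set w \<subseteq> A"
    using word_part[OF w] .
  show "z \<in> S"
    using w A c z
  proof (cases rule: arrival_cases)
    case stored
    obtain B where "B \<in> P" "set z \<subseteq> B"
      using stored A part_of[OF c] by auto
    moreover have "count_list z i \<le> 1" if "i \<in> V1" for i
      using w that stored by (auto simp: buffer_words_eq count_list_0_iff)
    ultimately show ?thesis by (auto simp: buffer_words_eq)
  qed (use w remove_in_buffer_words in auto)
qed

lemma kernel_closed: "w \<in> S \<Longrightarrow> set_pmf (K w) \<subseteq> S"
  using arrival_closed support by (auto simp: matching_kernel_eq)

lemma finite_arrival:
  assumes "w \<in> S" and "c \<in> V"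
  shows "finite (set_pmf (arrival E \<Phi> w c))"
proof (cases "compatible_positions E w c = {}")
  case False
  then have "set_pmf (\<Phi> w c) \<subseteq> compatible_positions E w c"
    using adm assms by (auto simp: admissible_def)
  then have "set_pmf (\<Phi> w c) \<subseteq> {..<length w}"
    by (auto simp: compatible_positions_def)
  then have "finite (set_pmf (\<Phi> w c))"
    by (rule finite_subset) simp
  then show ?thesis by (simp add: arrival_def)
qed (simp add: arrival_def)

lemma integrable_kernel: "w \<in> S \<Longrightarrow> integrable (K w) (f :: 'a list \<Rightarrow> real)"
  using finite_V support finite_arrival
  by (intro integrable_measure_pmf_finite) (auto simp: matching_kernel_eq)

text \<open>
  The form in which all drifts arise: the function gains at most one on arrivals in \<open>B\<close> and loses one
  on arrivals in \<open>C\<close>.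
\<close>

lemma kernel_drift_le:
  fixes f :: "'a list \<Rightarrow> real"
  assumes "w \<in> S"
    and "\<And>c z. c \<in> V \<Longrightarrow> z \<in> set_pmf (arrival E \<Phi> w c) \<Longrightarrow>
           f z \<le> a + (indicator B c - indicator C c)"
  shows "(\<integral>z. f z \<partial>K w) \<le> a + (measure_pmf.prob \<mu> B - measure_pmf.prob \<mu> C)"
proof -
  have "(\<integral>z. f z \<partial>K w) \<le> (\<integral>c. a + (indicator B c - indicator C c) \<partial>\<mu>)"
    unfolding matching_kernel_eq using assms finite_V support finite_arrival
    by (intro expectation_bind_pmf_le) auto
  also have "\<dots> = a + (measure_pmf.prob \<mu> B - measure_pmf.prob \<mu> C)"
    using finite_V support by (simp add: integrable_measure_pmf_finite)
  finally show ?thesis .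
qed

lemma step_to_shorter:
  assumes "w \<in> S" and "w \<noteq> []"
  shows "\<exists>z\<in>set_pmf (K w). z \<in> S \<and> length w = Suc (length z)"
proof -
  obtain A where A: "A \<in> P" "set w \<subseteq> A"
    using word_part[OF assms(1)] .
  obtain c where c: "c \<in> V" "c \<notin> A"
    using other_part_nonempty[OF A(1)] by auto
  obtain z where z: "z \<in> set_pmf (arrival E \<Phi> w c)"
    using set_pmf_not_empty by fast
  from assms(1) A c(1) z have "length w = Suc (length z)"
    by (cases rule: arrival_cases) (use assms c in auto)
  moreover have "z \<in> set_pmf (K w)"
    using z c support by (auto simp: matching_kernel_eq)
  ultimately show ?thesis
    using arrival_closed[OF assms(1) c(1)] z by auto
qed

abbreviation step :: "'a list \<Rightarrow> 'a list \<Rightarrow> bool" where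
  "step w z \<equiv> z \<in> set_pmf (K w)"

text \<open>
  Arrivals from a part other than that of the stored items empty the buffer one item at a time.
\<close>

lemma reach_Nil: "w \<in> S \<Longrightarrow> step\<^sup>*\<^sup>* w []"
proof (induction "length w" arbitrary: w)
  case (Suc n)
  have "w \<noteq> []" using Suc.hyps(2) by auto
  then obtain z where z: "step w z" "z \<in> S" "length w = Suc (length z)"
    using step_to_shorter[OF Suc.prems] by blast
  with Suc have "step\<^sup>*\<^sup>* z []" by auto
  with z(1) show ?case by (rule converse_rtranclp_into_rtranclp)
qed simp

text \<open>
  A buffer word contains no compatible pair, so arrivals in the order of the word are all stored.
\<close>

lemma reach_from_Nil: "w \<in> S \<Longrightarrow> step\<^sup>*\<^sup>* [] w"
proof (induction w rule: rev_induct)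
  case (snoc c w)
  have w: "w \<in> S"
    using remove_in_buffer_words[of w c "[]"] snoc.prems by simp
  obtain A where A: "A \<in> P" "set (w @ [c]) \<subseteq> A"
    using word_part[OF snoc.prems] .
  then have c: "c \<in> V" using part_subset by auto
  have loop: "c \<notin> set w" if "c \<in> V1"
    using snoc.prems that by (auto simp: buffer_words_eq count_list_0_iff)
  obtain z where z: "z \<in> set_pmf (arrival E \<Phi> w c)"
    using set_pmf_not_empty by fast
  have "set w \<subseteq> A" using A by auto
  from w A(1) this c z have "z = w @ [c]"
    by (cases rule: arrival_cases) (use A loop in auto)
  then have "step w (w @ [c])"
    using z c support by (auto simp: matching_kernel_eq)
  with snoc.IH[OF w] show ?case by (rule rtranclp.rtrancl_into_rtrancl)
qed simp

lemma step_Nil: "c \<in> V \<Longrightarrow> step [] [c]"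
  using support by (auto simp: matching_kernel_eq arrival_def compatible_positions_def)

lemma reachable:
  assumes "w \<in> S" and "w' \<in> S"
  shows "step\<^sup>+\<^sup>+ w w'"
proof -
  obtain z where "step w z"
    using set_pmf_not_empty by fast
  then have "step\<^sup>*\<^sup>* z w'"
    using kernel_closed[OF assms(1)] reach_Nil[of z] reach_from_Nil[OF assms(2)]
    by (meson rtranclp_trans subsetD)
  with \<open>step w z\<close> show ?thesis by (rule rtranclp_into_tranclp2)
qed

section \<open>Drift of the number of stored items\<close>

text \<open>
  The number of stored \<open>U\<close>-items is a Lyapunov function. As long as it is positive, every arrival
  outside the part \<open>A\<close> of the buffer meets a compatible \<open>U\<close>-item and, by priority, removes one, while
  only arrivals in \<open>A \<inter> U\<close> can add one. So the drift is at most \<open>\<mu> (A \<inter> U) - \<mu> (V - A) < 0\<close>. The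
  exceptional words consist of items with self-loops only, each present at most once, and there are
  finitely many of them. The parameter \<open>U\<close> covers both parts of the theorem: \<open>V\<^sub>2\<close> for
  favorable policies, and \<open>V\<close>, where priority is automatic.
\<close>

lemma positive_recurrent_if_prioritized:
  assumes U: "V - U \<subseteq> V1"
    and prio: "\<And>w c i. w \<in> S \<Longrightarrow> c \<in> V \<Longrightarrow> \<exists>j\<in>compatible_positions E w c. w ! j \<in> U \<Longrightarrow>
                 i \<in> set_pmf (\<Phi> w c) \<Longrightarrow> w ! i \<in> U"
    and less: "\<And>A. A \<in> P \<Longrightarrow> measure_pmf.prob \<mu> (A \<inter> U) < measure_pmf.prob \<mu> (V - A)"
  shows "positive_recurrent K S"
  unfolding positive_recurrent_def
proof
  fix x assume x: "x \<in> S"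
  define F where "F = {w \<in> S. count_in U w = 0}"
  define gap where "gap A = measure_pmf.prob \<mu> (V - A) - measure_pmf.prob \<mu> (A \<inter> U)" for A
  have "finite P" "P \<noteq> {}"
    using two_parts by (auto intro: card_ge_0_finite)
  show "positive_recurrent_state K x"
  proof (rule foster_lyapunov[where f = "count_in U" and F = F and C = 1 and \<epsilon> = "Min (gap ` P)"])
    show "finite F"
    proof (rule finite_subset)
      show "F \<subseteq> {w. set w \<subseteq> V \<and> length w \<le> card V}"
      proof (intro subsetI CollectI)
        fix w assume w: "w \<in> F"
        then have "set w \<subseteq> V" "set w \<inter> U = {}"
          by (auto simp: F_def buffer_words_def count_in_eq_0_iff)
        then have "count_list w i \<le> 1" if "i \<in> set w" for i
          using w U that by (auto simp: F_def buffer_words_def)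
        then have "distinct w"
          by (auto simp: distinct_count_atmost_1 count_list_0_iff le_Suc_eq count_mset)
        then show "set w \<subseteq> V \<and> length w \<le> card V"
          using \<open>set w \<subseteq> V\<close> card_mono[OF finite_V] by (auto simp: distinct_card[symmetric])
      qed
    qed (rule finite_lists_length_le[OF finite_V])
    show "0 < Min (gap ` P)"
      using \<open>finite P\<close> \<open>P \<noteq> {}\<close> less by (auto simp: gap_def)
    show "(\<integral>z. count_in U z \<partial>K w) \<le> count_in U w - Min (gap ` P)" if w: "w \<in> S - F" for w
    proof -
      have w': "w \<in> S" "set w \<inter> U \<noteq> {}"
        using w by (auto simp: F_def count_in_eq_0_iff)
      obtain A where A: "A \<in> P" "set w \<subseteq> A"
        using word_part[OF w'(1)] .
      have "(\<integral>z. count_in U z \<partial>K w)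
          \<le> count_in U w + (measure_pmf.prob \<mu> (A \<inter> U) - measure_pmf.prob \<mu> (V - A))"
      proof (rule kernel_drift_le[OF w'(1)])
        fix c z assume c: "c \<in> V" and z: "z \<in> set_pmf (arrival E \<Phi> w c)"
        from w'(1) A c z
        show "count_in U z \<le> count_in U w + (indicator (A \<inter> U) c - indicator (V - A) c)"
        proof (cases rule: arrival_cases)
          case (other_part u a v)
          obtain j where j: "j < length w" "w ! j \<in> U"
            using w'(2) by (auto simp: in_set_conv_nth)
          then have "w ! j \<in> A"
            using A(2) nth_mem by blast
          with j have "j \<in> compatible_positions E w c"
            using adj_iff[OF A(1), of "w ! j" c] c other_part(1)
            by (auto simp: compatible_positions_def adj_commute)
          then have "a \<in> U"
            using prio[OF w'(1) c] j other_part(4) by auto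
          then show ?thesis using other_part c by auto
        next
          case stored
          with w'(2) show ?thesis by (auto simp: indicator_def)
        qed (auto simp: indicator_def)
      qed
      moreover have "Min (gap ` P) \<le> gap A"
        using A \<open>finite P\<close> by (intro Min_le) auto
      ultimately show ?thesis by (simp add: gap_def[of A])
    qed
    show "(\<integral>z. count_in U z \<partial>K w) \<le> count_in U w + 1" if "w \<in> F" for w
    proof -
      have w: "w \<in> S" using that by (simp add: F_def)
      obtain A where A: "A \<in> P" "set w \<subseteq> A"
        using word_part[OF w] .
      have "(\<integral>z. count_in U z \<partial>K w)
          \<le> count_in U w + (measure_pmf.prob \<mu> UNIV - measure_pmf.prob \<mu> {})"
      proof (rule kernel_drift_le[OF w])
        fix c z assume c: "c \<in> V" and z: "z \<in> set_pmf (arrival E \<Phi> w c)"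
        from w A c z
        show "count_in U z \<le> count_in U w + (indicator UNIV c - indicator {} c)"
          by (cases rule: arrival_cases) (auto simp: indicator_def)
      qed
      then show ?thesis by simp
    qed
  qed (use x reachable kernel_closed integrable_kernel in \<open>auto simp: F_def count_in_nonneg\<close>)
qed

text \<open>
  Necessity holds for every admissible policy. If the inequality fails for the part \<open>A\<close>, the number of
  stored items of \<open>A \<inter> V2\<close> is a submartingale: when it is positive the buffer lies in \<open>A\<close>, each arrival
  in \<open>A \<inter> V2\<close> adds one because it has no compatible stored item, and an arrival outside \<open>A\<close> removes at
  most one. When it is zero it cannot decrease. Such a chain does not return to the empty buffer in
  finite mean time.
\<close>

lemma positive_recurrent_imp_less:
  assumes pr: "positive_recurrent K S" and A: "A \<in> P"
  shows "measure_pmf.prob \<mu> (A \<inter> V2) < measure_pmf.prob \<mu> (V - A)"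
proof (rule ccontr)
  assume "\<not> ?thesis"
  then have ge: "measure_pmf.prob \<mu> (V - A) \<le> measure_pmf.prob \<mu> (A \<inter> V2)" by simp
  have "measure_pmf.prob \<mu> (V - A) \<noteq> 0"
    using other_part_nonempty[OF A] support by (auto simp: measure_pmf_zero_iff)
  then have "measure_pmf.prob \<mu> (A \<inter> V2) \<noteq> 0"
    using ge by (metis measure_nonneg order_antisym)
  then obtain v where v: "v \<in> A" "v \<in> V2" "v \<in> V"
    using support by (auto simp: measure_pmf_zero_iff)
  let ?f = "count_in (A \<inter> V2)"
  have "\<not> positive_recurrent_state K []"
  proof (rule submartingale_not_positive_recurrent[where f = ?f and y = "[v]"])
    fix w assume w: "w \<in> S"
    then obtain B where B: "B \<in> P" "set w \<subseteq> B"
      using word_part by blast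
    show "?f z \<le> ?f w + 1" if step: "z \<in> set_pmf (K w)" for z
    proof -
      obtain c where c: "c \<in> V" and z: "z \<in> set_pmf (arrival E \<Phi> w c)"
        using step support unfolding matching_kernel_eq set_bind_pmf by blast
      from w B c z show ?thesis
        by (cases rule: arrival_cases) (auto simp: indicator_def)
    qed
    show "?f w \<le> (\<integral>z. ?f z \<partial>K w)"
    proof (cases "?f w = 0")
      case True
      then show ?thesis by (simp add: count_in_nonneg)
    next
      case False
      then have "A \<inter> B \<noteq> {}" "w \<noteq> []"
        using B by (auto simp: count_in_eq_0_iff)
      then have "B = A"
        using A B partition_onD2[OF partition] by (auto simp: disjoint_def)
      have "(\<integral>z. - ?f z \<partial>K w)
          \<le> - ?f w + (measure_pmf.prob \<mu> (V - A) - measure_pmf.prob \<mu> (A \<inter> V2))"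
      proof (rule kernel_drift_le[OF w])
        fix c z assume c: "c \<in> V" and z: "z \<in> set_pmf (arrival E \<Phi> w c)"
        from w B c z
        show "- ?f z \<le> - ?f w + (indicator (V - A) c - indicator (A \<inter> V2) c)"
          unfolding \<open>B = A\<close>
          by (cases rule: arrival_cases)
             (use c \<open>w \<noteq> []\<close> in \<open>auto simp: indicator_def loopless_nodes_def\<close>)
      qed
      then show ?thesis using ge by simp
    qed
  qed (use v step_Nil kernel_closed integrable_kernel Nil_in_buffer_words in auto)
  then show False
    using pr Nil_in_buffer_words by (simp add: positive_recurrent_def)
qed

end

section \<open>Maximality of favorable policies\<close>

lemma adj_no_loops_iff: "adj (no_loops E) u v \<longleftrightarrow> adj E u v \<and> u \<noteq> v"
  by (auto simp: adj_def no_loops_def doubleton_eq_iff)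

text \<open>
  The maximal subgraph is complete multipartite for the same partition, so \<open>Ncond_iff\<close>
  describes the stability conditions of both graphs.
\<close>

lemma complete_multipartite_imp_locale:
  assumes "multigraph V E" and "partition_on V P" and "2 \<le> card P"
    and indep: "P \<subseteq> indep_sets_of V (no_loops E)"
    and complete: "\<And>A B u v. A \<in> P \<Longrightarrow> B \<in> P \<Longrightarrow> A \<noteq> B \<Longrightarrow> u \<in> A \<Longrightarrow> v \<in> B \<Longrightarrow> adj (no_loops E) u v"
  shows "multipartite_multigraph V E P" and "multipartite_multigraph V (no_loops E) P"
proof -
  have *: "adj (no_loops E) u v \<longleftrightarrow> v \<notin> A" if "A \<in> P" "u \<in> A" "v \<in> V" for A u v
  proof
    assume "adj (no_loops E) u v"
    then show "v \<notin> A" using that indep by (auto simp: indep_sets_of_def)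
  next
    assume "v \<notin> A"
    obtain B where "B \<in> P" "v \<in> B"
      using partition_onD1[OF assms(2)] \<open>v \<in> V\<close> by auto
    then show "adj (no_loops E) u v"
      using complete[of A B u v] that \<open>v \<notin> A\<close> by auto
  qed
  have "A \<subseteq> V" if "A \<in> P" for A
    using partition_onD1[OF assms(2)] that by auto
  then have loop: "adj E u u \<longleftrightarrow> u \<in> loop_nodes V E" if "A \<in> P" "u \<in> A" for A u
    using that by (auto simp: loop_nodes_def)
  have "finite V"
    using assms(1) by (simp add: multigraph_def)
  then show "multipartite_multigraph V E P"
  proof (rule multipartite_multigraph.intro[OF _ assms(2,3)])
    show "adj E u v \<longleftrightarrow> v \<notin> A \<or> (u = v \<and> u \<in> loop_nodes V E)"
      if "A \<in> P" "u \<in> A" "v \<in> V" for A u v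
      using *[OF that] loop[OF that(1,2)] that(2) by (cases "u = v") (simp_all add: adj_no_loops_iff)
  qed
  from \<open>finite V\<close> show "multipartite_multigraph V (no_loops E) P"
  proof (rule multipartite_multigraph.intro[OF _ assms(2,3)])
    show "adj (no_loops E) u v \<longleftrightarrow> v \<notin> A \<or> (u = v \<and> u \<in> loop_nodes V (no_loops E))"
      if "A \<in> P" "u \<in> A" "v \<in> V" for A u v
      using *[OF that] by (simp add: loop_nodes_def adj_no_loops_iff)
  qed
qed

theorem theorem5p3:
  fixes V :: "'a set" and E :: "'a set set" and p :: nat
  assumes "multigraph V E" and "graph_connected V E"
    and "complete_multipartite V E p" and "p \<ge> 2"
  shows "((p \<ge> 3 \<or> loop_nodes V E \<noteq> {}) \<longrightarrow>
            (\<forall>\<Phi>. V2_favorable V E \<Phi> \<longrightarrow> Stab V E \<Phi> = Ncond V E)) \<and>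
         (p \<ge> 3 \<longrightarrow>
            (\<forall>\<Phi>. admissible V E \<Phi> \<longrightarrow> Ncond V (no_loops E) \<subseteq> Stab V E \<Phi>))"
proof -
  obtain P where P: "partition_on V P" "card P = p" "P \<subseteq> indep_sets_of V (no_loops E)"
    "\<And>A B u v. A \<in> P \<Longrightarrow> B \<in> P \<Longrightarrow> A \<noteq> B \<Longrightarrow> u \<in> A \<Longrightarrow> v \<in> B \<Longrightarrow> adj (no_loops E) u v"
    using assms(3) unfolding complete_multipartite_def by metis
  interpret G: multipartite_multigraph V E P
    using assms P by (intro complete_multipartite_imp_locale) auto
  interpret H: multipartite_multigraph V "no_loops E" P
    using assms P by (intro complete_multipartite_imp_locale) auto
  have model: "multipartite_matching V E P \<mu> \<Phi>" if "\<mu> \<in> full_support V" "admissible V E \<Phi>" for \<mu> \<Phi>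
    using that by unfold_locales (auto simp: full_support_def)
  have "Stab V E \<Phi> = Ncond V E" if fav: "V2_favorable V E \<Phi>" for \<Phi>
  proof -
    have "positive_recurrent (matching_kernel E \<Phi> \<mu>) (buffer_words V E) \<longleftrightarrow> \<mu> \<in> Ncond V E"
      if \<mu>: "\<mu> \<in> full_support V" for \<mu>
    proof -
      interpret multipartite_matching V E P \<mu> \<Phi>
        using model \<mu> fav by (auto simp: V2_favorable_def)
      have prio: "w ! i \<in> G.V2"
        if "w \<in> S" "c \<in> V" "\<exists>j\<in>compatible_positions E w c. w ! j \<in> G.V2" "i \<in> set_pmf (\<Phi> w c)" for w c i
      proof -
        have "compatible_positions E w c \<noteq> {}" using that by auto
        then have "i \<in> compatible_positions E w c"
          using adm that by (auto simp: admissible_def)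
        then have "w ! i \<in> V"
          using \<open>w \<in> S\<close> by (auto simp: compatible_positions_def buffer_words_def)
        moreover have "w ! i \<notin> G.V1"
          using fav that unfolding V2_favorable_def by blast
        ultimately show ?thesis
          by (simp add: loopless_nodes_def)
      qed
      have "positive_recurrent K S"
        if less: "\<forall>A\<in>P. measure_pmf.prob \<mu> (A \<inter> G.V2) < measure_pmf.prob \<mu> (V - A)"
      proof (rule positive_recurrent_if_prioritized[of G.V2, OF _ prio])
        show "V - G.V2 \<subseteq> G.V1"
          by (auto simp: loopless_nodes_def)
      qed (use less in blast)+
      then show ?thesis
        unfolding G.Ncond_iff[OF support] using positive_recurrent_imp_less by blast
    qed
    then show ?thesis
      by (auto simp: Stab_def Ncond_def)
  qed
  moreover have "Ncond V (no_loops E) \<subseteq> Stab V E \<Phi>" if adm: "admissible V E \<Phi>" for \<Phi>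
  proof
    fix \<mu> assume N: "\<mu> \<in> Ncond V (no_loops E)"
    then have \<mu>: "\<mu> \<in> full_support V"
      by (simp add: Ncond_def)
    interpret multipartite_matching V E P \<mu> \<Phi>
      by (rule model[OF \<mu> adm])
    \<comment> \<open>Without self-loops every node is loopless, so \<open>Ncond\<close> of the maximal subgraph bounds whole parts.\<close>
    have "H.V2 = V"
      by (auto simp: loopless_nodes_def loop_nodes_def adj_no_loops_iff)
    then have less: "measure_pmf.prob \<mu> (A \<inter> V) < measure_pmf.prob \<mu> (V - A)" if "A \<in> P" for A
      using N that H.Ncond_iff[OF support] by auto
    have prio: "w ! i \<in> V"
      if "w \<in> S" "c \<in> V" "\<exists>j\<in>compatible_positions E w c. w ! j \<in> V" "i \<in> set_pmf (\<Phi> w c)" for w c i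
    proof -
      have "compatible_positions E w c \<noteq> {}" using that by auto
      then have "i \<in> compatible_positions E w c"
        using adm that by (auto simp: admissible_def)
      then show ?thesis
        using \<open>w \<in> S\<close> by (auto simp: compatible_positions_def buffer_words_def)
    qed
    have "positive_recurrent K S"
      by (rule positive_recurrent_if_prioritized[of V, OF _ prio less]) auto
    with \<mu> show "\<mu> \<in> Stab V E \<Phi>"
      by (simp add: Stab_def)
  qed
  ultimately show ?thesis by blast
qed

end
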